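(* Let $f(z_1,z_2)=\left(1-\frac{z_1+z_2}{\sqrt 6}\right)^{-5/2}$ on $\mathbb{D}^2$, and let $p_1$ be the optimal polynomial approximant of degree $1$ to $1/f$ in $H^2(\mathbb{D}^2)$, that is, the unique polynomial of the form $p(z_1,z_2)=\alpha+\beta z_1+\gamma z_2$ with $\alpha,\beta,\gamma\in\mathbb{C}$ which minimizes $\|1-pf\|_{H^2(\mathbb{D}^2)}$ among all polynomials of this form. Then $p_1$ has a zero in $\mathbb{D}^2$.
   Context: $\mathbb{D}=\{z\in\mathbb{C}:|z|<1\}$ and $\mathbb{D}^2=\mathbb{D}\times\mathbb{D}$. The Hardy space $H^2(\mathbb{D}^2)$ is the Hilbert space of holomorphic functions $g(z_1,z_2)=\sum_{k,l\ge 0}a_{k,l}z_1^kz_2^l$ on $\mathbb{D}^2$ with $\|g\|_{H^2(\mathbb{D}^2)}=\left(\sum_{k,l\ge 0}|a_{k,l}|^2\right)^{1/2}<\infty$. The power $-5/2$ is taken with the principal branch, so $f(0,0)=1$ (note $|z_1+z_2|/\sqrt6<1$ on $\overline{\mathbb{D}}^2$). The minimizer exists and is unique because $p_1f$ is the orthogonal projection of $1$ onto the $3$-dimensional subspace $\mathrm{span}\{f,z_1f,z_2f\}$. *)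

theory Defs
  imports "HOL-Complex_Analysis.Complex_Analysis"
begin

definition bidisc :: "(complex \<times> complex) set" where
  "bidisc = ball 0 1 \<times> ball 0 1"

text \<open>Holomorphy in two variables: complex differentiability at every point of the bidisc,
  i.e. real differentiability with a complex-linear derivative.\<close>

definition holomorphic_on_bidisc :: "(complex \<times> complex \<Rightarrow> complex) \<Rightarrow> bool" where
  "holomorphic_on_bidisc g \<longleftrightarrow>
     (\<forall>z\<in>bidisc. \<exists>a b. (g has_derivative (\<lambda>(h1, h2). a * h1 + b * h2)) (at z))"

definition expands_on_bidisc ::
    "(nat \<times> nat \<Rightarrow> complex) \<Rightarrow> (complex \<times> complex \<Rightarrow> complex) \<Rightarrow> bool" where
  "expands_on_bidisc a g \<longleftrightarrow>
     (\<forall>(z1, z2)\<in>bidisc. ((\<lambda>(k, l). a (k, l) * z1 ^ k * z2 ^ l) has_sum g (z1, z2)) UNIV)"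

text \<open>A power series expansion on the bidisc is unique if it exists, and every function that
  is holomorphic on the bidisc has one, so the description below is proper for such functions.\<close>

definition taylor_coeff2 :: "(complex \<times> complex \<Rightarrow> complex) \<Rightarrow> nat \<times> nat \<Rightarrow> complex" where
  "taylor_coeff2 g = (THE a. expands_on_bidisc a g)"

text \<open>Functions are total on pairs of complex numbers, but only their values on the (open)
  bidisc matter for membership in the Hardy space and for the norm.\<close>

definition hardy2 :: "(complex \<times> complex \<Rightarrow> complex) set" where
  "hardy2 = {g. holomorphic_on_bidisc g \<and>
     (\<exists>a. expands_on_bidisc a g \<and> (\<lambda>kl. (cmod (a kl))\<^sup>2) summable_on UNIV)}"

definition hardy2_norm :: "(complex \<times> complex \<Rightarrow> complex) \<Rightarrow> real" where
  "hardy2_norm g = sqrt (\<Sum>\<^sub>\<infinity>kl\<in>UNIV. (cmod (taylor_coeff2 g kl))\<^sup>2)"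

definition poly2_deg1 :: "(complex \<times> complex \<Rightarrow> complex) set" where
  "poly2_deg1 = {p. \<exists>\<alpha> \<beta> \<gamma>. p = (\<lambda>(z1, z2). \<alpha> + \<beta> * z1 + \<gamma> * z2)}"

text \<open>The requirement that \<open>f\<close> lies in the Hardy space, which is closed under multiplication
  by polynomials, excludes the case where the norms compared here are junk values of
  divergent sums.\<close>

definition is_opa1 ::
    "(complex \<times> complex \<Rightarrow> complex) \<Rightarrow> (complex \<times> complex \<Rightarrow> complex) \<Rightarrow> bool" where
  "is_opa1 f p \<longleftrightarrow> f \<in> hardy2 \<and> p \<in> poly2_deg1 \<and>
     (\<forall>q\<in>poly2_deg1. hardy2_norm (\<lambda>z. 1 - p z * f z) \<le> hardy2_norm (\<lambda>z. 1 - q z * f z))"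

end

theory Submission
  imports Defs
begin

text \<open>The coefficients of \<open>f\<close> are real and symmetric, so the Gram matrix of \<open>f, z\<^sub>1f, z\<^sub>2f\<close> has
  only three distinct entries: \<open>A\<close> (the squared norms), \<open>B = \<langle>f, z\<^sub>1f\<rangle>\<close> and
  \<open>C = \<langle>z\<^sub>1f, z\<^sub>2f\<rangle>\<close>. The normal equations give \<open>p\<^sub>1 = \<alpha> (1 - B / (A + C) * (z\<^sub>1 + z\<^sub>2))\<close>,
  which vanishes at \<open>z\<^sub>1 = z\<^sub>2 = (A + C) / (2B)\<close>, so everything reduces to \<open>A + C < 2B\<close>.
  Summing along the diagonals \<open>k + l = n\<close> with Vandermonde's identity turns \<open>2B - (A + C)\<close>
  into a single series whose first 12 terms outweigh the negative, geometrically decaying tail.\<close>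

section \<open>Double power series on the bidisc\<close>

lemma has_sum_diff:
  fixes f g :: "'a \<Rightarrow> 'b :: real_normed_vector"
  assumes "(f has_sum s) A" "(g has_sum t) A"
  shows "((\<lambda>x. f x - g x) has_sum (s - t)) A"
  using has_sum_add[OF assms(1), of "\<lambda>x. - g x" "- t"] assms(2) by (simp add: has_sum_uminus)

text \<open>The map from \<open>(n, k)\<close> to \<open>(k, n - k)\<close> is a bijection of the
  triangle \<open>k \<le> n\<close> onto all index pairs. The hypothesis makes the whole family
  absolutely summable, so it may be regrouped by total degree.\<close>

lemma has_sum_diagonal:
  fixes F :: "nat \<times> nat \<Rightarrow> 'a :: banach"
  assumes "summable (\<lambda>n. \<Sum>k\<le>n. norm (F (k, n - k)))"
  shows "(F has_sum (\<Sum>n. \<Sum>k\<le>n. F (k, n - k))) UNIV"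
proof -
  define j :: "nat \<times> nat \<Rightarrow> nat \<times> nat" where "j = (\<lambda>(n, k). (k, n - k))"
  have j: "bij_betw j (SIGMA n:UNIV. {..n}) UNIV"
    by (rule bij_betwI[where g = "\<lambda>(k, l). (k + l, k)"]) (auto simp: j_def)
  have "(\<lambda>x. norm (F (j x))) summable_on (SIGMA n:UNIV. {..n})"
  proof (rule summable_on_SigmaI)
    show "((\<lambda>y. norm (F (j (n, y)))) has_sum (\<Sum>k\<le>n. norm (F (k, n - k)))) {..n}" for n
      by (rule has_sum_finiteI) (auto simp: j_def)
    show "(\<lambda>n. \<Sum>k\<le>n. norm (F (k, n - k))) summable_on UNIV"
      by (intro summable_nonneg_imp_summable_on assms sum_nonneg norm_ge_zero)
  qed auto
  then have summ: "(\<lambda>x. F (j x)) summable_on (SIGMA n:UNIV. {..n})"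
    by (rule abs_summable_summable)
  have sm: "summable (\<lambda>n. norm (\<Sum>k\<le>n. F (k, n - k)))"
    by (rule summable_comparison_test'[OF assms]) (simp add: norm_sum)
  have "((\<lambda>x. F (j x)) has_sum (\<Sum>n. \<Sum>k\<le>n. F (k, n - k))) (SIGMA n:UNIV. {..n})"
  proof (rule has_sum_SigmaI[OF _ _ summ])
    show "((\<lambda>y. F (j (n, y))) has_sum (\<Sum>k\<le>n. F (k, n - k))) {..n}" for n
      by (rule has_sum_finiteI) (auto simp: j_def)
    show "((\<lambda>n. \<Sum>k\<le>n. F (k, n - k)) has_sum (\<Sum>n. \<Sum>k\<le>n. F (k, n - k))) UNIV"
      by (rule norm_summable_imp_has_sum[OF sm])
         (intro summable_sums summable_norm_cancel[OF sm])
  qed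
  then show ?thesis
    by (simp add: has_sum_reindex_bij_betw[OF j])
qed

corollary has_sum_diagonal_nonneg:
  fixes F :: "nat \<times> nat \<Rightarrow> real"
  assumes "\<And>x. 0 \<le> F x" "\<And>n. (\<Sum>k\<le>n. F (k, n - k)) = g n" "summable g"
  shows "(F has_sum suminf g) UNIV"
  using has_sum_diagonal[of F] assms by simp

section \<open>Uniqueness of expansions\<close>

lemma power_series_zero_imp_coeff_zero:
  fixes a :: "nat \<Rightarrow> complex"
  assumes "\<And>z. norm z < 1 \<Longrightarrow> (\<lambda>n. a n * z ^ n) sums 0"
  shows "a n = 0"
proof (rule ccontr)
  assume nz: "a n \<noteq> 0"
  \<comment> \<open>Isolation of zeros (\<open>powser_0_nonzero\<close>) asks for a nonzero
    coefficient of positive index, so index 0 is ruled out first.\<close>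
  have a0: "a 0 = 0"
    using assms[of 0] by simp
  with nz have "n > 0" by (cases n) auto
  show False
  proof (rule powser_0_nonzero[of 1 0 a "\<lambda>_. 0" n])
    fix s :: real assume s: "0 < s" "\<And>z :: complex. z \<in> cball 0 s - {0} \<Longrightarrow> (0::complex) \<noteq> 0"
    from s(2)[of "of_real s"] s(1) show False by simp
  qed (use assms nz \<open>n > 0\<close> in simp_all)
qed

lemma bidisc_iff [simp]: "(z1, z2) \<in> bidisc \<longleftrightarrow> norm z1 < 1 \<and> norm z2 < 1"
  by (simp add: bidisc_def)

lemma expands_on_bidiscI:
  assumes "\<And>z1 z2. norm z1 < 1 \<Longrightarrow> norm z2 < 1 \<Longrightarrow>
    ((\<lambda>(k, l). a (k, l) * z1 ^ k * z2 ^ l) has_sum g (z1, z2)) UNIV"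
  shows "expands_on_bidisc a g"
  using assms by (auto simp: expands_on_bidisc_def)

lemma expands_on_bidiscD:
  assumes "expands_on_bidisc a g" "norm z1 < 1" "norm z2 < 1"
  shows "((\<lambda>(k, l). a (k, l) * z1 ^ k * z2 ^ l) has_sum g (z1, z2)) UNIV"
  using assms by (force simp: expands_on_bidisc_def)

lemma expands_on_bidisc_add:
  assumes "expands_on_bidisc a g" "expands_on_bidisc b h"
  shows "expands_on_bidisc (\<lambda>x. a x + b x) (\<lambda>z. g z + h z)"
proof (rule expands_on_bidiscI)
  fix z1 z2 :: complex assume z: "norm z1 < 1" "norm z2 < 1"
  show "((\<lambda>(k, l). (a (k, l) + b (k, l)) * z1 ^ k * z2 ^ l) has_sum g (z1, z2) + h (z1, z2)) UNIV"
    using has_sum_add[OF assms[THEN expands_on_bidiscD, OF z]]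
    by (simp add: case_prod_unfold algebra_simps)
qed

lemma expands_on_bidisc_cmult:
  assumes "expands_on_bidisc a g"
  shows "expands_on_bidisc (\<lambda>x. c * a x) (\<lambda>z. c * g z)"
proof (rule expands_on_bidiscI)
  fix z1 z2 :: complex assume z: "norm z1 < 1" "norm z2 < 1"
  show "((\<lambda>(k, l). (c * a (k, l)) * z1 ^ k * z2 ^ l) has_sum c * g (z1, z2)) UNIV"
    using has_sum_cmult_right[OF expands_on_bidiscD[OF assms z], of c]
    by (simp add: case_prod_unfold algebra_simps)
qed

text \<open>The one-variable case is applied twice. For fixed \<open>z2\<close>, summing over
  \<open>l\<close> first leaves a power series in \<open>z1\<close> that vanishes on the disc; each
  of its coefficients is in turn a vanishing power series in \<open>z2\<close>.\<close>

lemma expands_on_bidisc_unique: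
  assumes "expands_on_bidisc a g" "expands_on_bidisc b g"
  shows "a = b"
proof
  fix x :: "nat \<times> nat"
  define d where "d = (\<lambda>x. a x + (-1) * b x)"
  have d: "expands_on_bidisc d (\<lambda>_. 0)"
    using expands_on_bidisc_add[OF assms(1) expands_on_bidisc_cmult[OF assms(2), of "-1"]]
    by (simp add: d_def)
  have "d (k, l) = 0" for k l
  proof -
    have inner: "(\<Sum>\<^sub>\<infinity>l. d (k, l) * z2 ^ l) = 0 \<and> (\<lambda>l. d (k, l) * z2 ^ l) summable_on UNIV"
      if z2: "norm z2 < 1" for k z2
    proof -
      have summ: "(\<lambda>(k, l). d (k, l) * z1 ^ k * z2 ^ l) summable_on (UNIV \<times> UNIV)"
        if "norm z1 < 1" for z1
        using expands_on_bidiscD[OF d that z2] by (auto simp: summable_on_def)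
      \<comment> \<open>Any nonzero \<open>z1\<close> in the disc would serve: cancelling
        \<open>z1 ^ k\<close> leaves summability of each row.\<close>
      have "(\<lambda>l. d (k, l) * (1/2) ^ k * z2 ^ l) summable_on UNIV" for k
        using summable_on_SigmaD1[OF summ[of "1/2"], of k] by simp
      from summable_on_cmult_right[OF this]
      have "(\<lambda>l. 2 ^ k * (d (k, l) * (1/2) ^ k * z2 ^ l)) summable_on UNIV" for k .
      then have inner: "(\<lambda>l. d (k, l) * z2 ^ l) summable_on UNIV" for k
        by (simp add: power_divide)
      have "(\<lambda>k. (\<Sum>\<^sub>\<infinity>l. d (k, l) * z2 ^ l) * z1 ^ k) sums 0" if z1: "norm z1 < 1" for z1
      proof (rule has_sum_imp_sums)
        have "((\<lambda>l. z1 ^ k * (d (k, l) * z2 ^ l)) has_sum z1 ^ k * (\<Sum>\<^sub>\<infinity>l. d (k, l) * z2 ^ l)) UNIV"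
          for k
          by (intro has_sum_cmult_right has_sum_infsum inner)
        then have row: "((\<lambda>l. d (k, l) * z1 ^ k * z2 ^ l) has_sum
            (\<Sum>\<^sub>\<infinity>l. d (k, l) * z2 ^ l) * z1 ^ k) UNIV" for k
          by (simp add: mult_ac)
        have "((\<lambda>(k, l). d (k, l) * z1 ^ k * z2 ^ l) has_sum 0) (UNIV \<times> UNIV)"
          using expands_on_bidiscD[OF d z1 z2] by simp
        then show "((\<lambda>k. (\<Sum>\<^sub>\<infinity>l. d (k, l) * z2 ^ l) * z1 ^ k) has_sum 0) UNIV"
          by (rule has_sum_SigmaD) (simp add: row)
      qed
      then have "(\<Sum>\<^sub>\<infinity>l. d (k, l) * z2 ^ l) = 0"
        by (rule power_series_zero_imp_coeff_zero[where n = k])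
      with inner show ?thesis by blast
    qed
    have "(\<lambda>l. d (k, l) * z2 ^ l) sums 0" if "norm z2 < 1" for z2
      using inner[OF that, of k] by (intro has_sum_imp_sums) (simp add: has_sum_iff)
    then show ?thesis
      by (rule power_series_zero_imp_coeff_zero)
  qed
  then show "a x = b x"
    by (cases x) (simp add: d_def)
qed

lemma taylor_coeff2_eq:
  assumes "expands_on_bidisc a g"
  shows "taylor_coeff2 g = a"
  unfolding taylor_coeff2_def using assms expands_on_bidisc_unique by blast

text \<open>Coefficient arrays of \<open>z1 * g\<close> and \<open>z2 * g\<close>. The type is
  general because the shifts act on complex expansions and on the real coefficients of
  \<open>f\<close> alike.\<close>

definition shift1 :: "(nat \<times> nat \<Rightarrow> 'a::zero) \<Rightarrow> nat \<times> nat \<Rightarrow> 'a" where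
  "shift1 a = (\<lambda>(k, l). if k = 0 then 0 else a (k - 1, l))"

definition shift2 :: "(nat \<times> nat \<Rightarrow> 'a::zero) \<Rightarrow> nat \<times> nat \<Rightarrow> 'a" where
  "shift2 a = (\<lambda>(k, l). if l = 0 then 0 else a (k, l - 1))"

definition unit2 :: "nat \<times> nat \<Rightarrow> 'a::zero_neq_one" where
  "unit2 = (\<lambda>x. if x = (0, 0) then 1 else 0)"

text \<open>Serves both for multiplying expansions by \<open>z1\<close> and for computing inner
  products of shifted arrays.\<close>

lemma has_sum_Suc_fst:
  fixes F :: "nat \<times> 'a \<Rightarrow> 'b :: topological_comm_monoid_add"
  assumes "\<And>l. F (0, l) = 0"
  shows "(F has_sum s) UNIV \<longleftrightarrow> ((\<lambda>(k, l). F (Suc k, l)) has_sum s) UNIV"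
proof -
  have "(F has_sum s) UNIV \<longleftrightarrow> (F has_sum s) (range (\<lambda>(k, l). (Suc k, l)))"
  proof (rule has_sum_cong_neutral)
    fix x :: "nat \<times> 'a" assume x: "x \<in> UNIV - range (\<lambda>(k, l). (Suc k, l))"
    obtain k l where "x = (k, l)" by (cases x)
    with x have "k = 0" by (cases k) auto
    with assms \<open>x = (k, l)\<close> show "F x = 0" by simp
  qed auto
  also have "\<dots> \<longleftrightarrow> (F \<circ> (\<lambda>(k, l). (Suc k, l)) has_sum s) UNIV"
    by (rule has_sum_reindex) (auto simp: inj_on_def)
  finally show ?thesis
    by (simp add: o_def case_prod_unfold)
qed

lemma has_sum_prod_swap:
  "(F has_sum s) (UNIV :: ('a \<times> 'b) set) \<longleftrightarrow> ((\<lambda>(k, l). F (l, k)) has_sum s) UNIV"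
  using has_sum_swap[of F UNIV UNIV s] by simp

lemma has_sum_Suc_snd:
  fixes F :: "'a \<times> nat \<Rightarrow> 'b :: topological_comm_monoid_add"
  assumes "\<And>k. F (k, 0) = 0"
  shows "(F has_sum s) UNIV \<longleftrightarrow> ((\<lambda>(k, l). F (k, Suc l)) has_sum s) UNIV"
proof -
  have "(F has_sum s) UNIV \<longleftrightarrow> ((\<lambda>(k, l). F (l, k)) has_sum s) UNIV"
    by (rule has_sum_prod_swap)
  also have "\<dots> \<longleftrightarrow> ((\<lambda>(k, l). F (l, Suc k)) has_sum s) UNIV"
    by (subst has_sum_Suc_fst) (simp_all add: assms)
  also have "\<dots> \<longleftrightarrow> ((\<lambda>(k, l). F (k, Suc l)) has_sum s) UNIV"
    by (subst has_sum_prod_swap) simp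
  finally show ?thesis .
qed

lemma expands_on_bidisc_shift1:
  assumes "expands_on_bidisc a g"
  shows "expands_on_bidisc (shift1 a) (\<lambda>(z1, z2). z1 * g (z1, z2))"
proof (rule expands_on_bidiscI)
  fix z1 z2 :: complex assume z: "norm z1 < 1" "norm z2 < 1"
  show "((\<lambda>(k, l). shift1 a (k, l) * z1 ^ k * z2 ^ l) has_sum
          (case (z1, z2) of (z1, z2) \<Rightarrow> z1 * g (z1, z2))) UNIV"
    using has_sum_cmult_right[OF expands_on_bidiscD[OF assms z], of z1]
    by (subst has_sum_Suc_fst) (simp_all add: shift1_def case_prod_unfold algebra_simps)
qed

lemma expands_on_bidisc_shift2:
  assumes "expands_on_bidisc a g"
  shows "expands_on_bidisc (shift2 a) (\<lambda>(z1, z2). z2 * g (z1, z2))"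
proof (rule expands_on_bidiscI)
  fix z1 z2 :: complex assume z: "norm z1 < 1" "norm z2 < 1"
  show "((\<lambda>(k, l). shift2 a (k, l) * z1 ^ k * z2 ^ l) has_sum
          (case (z1, z2) of (z1, z2) \<Rightarrow> z2 * g (z1, z2))) UNIV"
    using has_sum_cmult_right[OF expands_on_bidiscD[OF assms z], of z2]
    by (subst has_sum_Suc_snd) (simp_all add: shift2_def case_prod_unfold algebra_simps)
qed

lemma expands_on_bidisc_one: "expands_on_bidisc unit2 (\<lambda>_. 1)"
proof (rule expands_on_bidiscI)
  fix z1 z2 :: complex
  show "((\<lambda>(k, l). unit2 (k, l) * z1 ^ k * z2 ^ l) has_sum 1) UNIV"
    by (rule has_sum_finite_neutralI[of "{(0, 0)}"]) (auto simp: unit2_def split: if_splits)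
qed

text \<open>The coefficient array of \<open>1 - p * f\<close> for
  \<open>p = \<alpha> + \<beta> * z1 + \<gamma> * z2\<close>, when \<open>a\<close> is that of
  \<open>f\<close>.\<close>

definition residual :: "(nat \<times> nat \<Rightarrow> complex) \<Rightarrow> complex \<Rightarrow> complex \<Rightarrow> complex \<Rightarrow> nat \<times> nat \<Rightarrow> complex"
  where "residual a \<alpha> \<beta> \<gamma> = (\<lambda>x. unit2 x - (\<alpha> * a x + \<beta> * shift1 a x + \<gamma> * shift2 a x))"

lemma hardy2_norm_residual:
  assumes "expands_on_bidisc a f"
  shows "hardy2_norm (\<lambda>z. 1 - (case z of (z1, z2) \<Rightarrow> \<alpha> + \<beta> * z1 + \<gamma> * z2) * f z) =
    sqrt (\<Sum>\<^sub>\<infinity>x\<in>UNIV. (cmod (residual a \<alpha> \<beta> \<gamma> x))\<^sup>2)"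
proof -
  have "expands_on_bidisc (\<lambda>x. unit2 x + ((-\<alpha>) * a x + ((-\<beta>) * shift1 a x + (-\<gamma>) * shift2 a x)))
    (\<lambda>z. 1 + ((-\<alpha>) * f z + ((-\<beta>) * (case z of (z1, z2) \<Rightarrow> z1 * f (z1, z2))
                           + (-\<gamma>) * (case z of (z1, z2) \<Rightarrow> z2 * f (z1, z2)))))"
    by (intro expands_on_bidisc_add expands_on_bidisc_cmult expands_on_bidisc_one assms
        expands_on_bidisc_shift1[OF assms] expands_on_bidisc_shift2[OF assms])
  then have "expands_on_bidisc (residual a \<alpha> \<beta> \<gamma>)
      (\<lambda>z. 1 - (case z of (z1, z2) \<Rightarrow> \<alpha> + \<beta> * z1 + \<gamma> * z2) * f z)"
    by (simp add: residual_def case_prod_unfold algebra_simps)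
  then show ?thesis
    by (simp add: hardy2_norm_def taylor_coeff2_eq)
qed

section \<open>Optimal approximants via the normal equations\<close>

text \<open>The residual of the candidate is orthogonal to the arrays of \<open>f\<close>,
  \<open>z1 * f\<close>, \<open>z2 * f\<close>. By Pythagoras any other choice adds the squared norm
  of a nontrivial combination of these independent arrays, which gives minimality and uniqueness at
  once.\<close>

lemma is_opa1_iff_normal_equations:
  fixes a :: "nat \<times> nat \<Rightarrow> real" and f :: "complex \<times> complex \<Rightarrow> complex"
  assumes f: "f \<in> hardy2" "expands_on_bidisc (\<lambda>x. of_real (a x)) f"
    and a00: "a (0, 0) = 1"
    and XX: "((\<lambda>x. a x * a x) has_sum A) UNIV"
    and XY: "((\<lambda>x. a x * shift1 a x) has_sum B) UNIV"
    and XZ: "((\<lambda>x. a x * shift2 a x) has_sum B) UNIV"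
    and YZ: "((\<lambda>x. shift1 a x * shift2 a x) has_sum C) UNIV"
    and "C \<ge> 0"
  obtains \<alpha> where "\<And>p. is_opa1 f p \<longleftrightarrow>
    p = (\<lambda>(z1, z2). of_real \<alpha> + of_real (- \<alpha> * B / (A + C)) * z1 + of_real (- \<alpha> * B / (A + C)) * z2)"
proof -
  define X Y Z where XYZ: "X = a" "Y = shift1 a" "Z = shift2 a"
  define e :: "nat \<times> nat \<Rightarrow> real" where "e = unit2"
  note XX = XX[folded XYZ] and XY = XY[folded XYZ] and XZ = XZ[folded XYZ] and YZ = YZ[folded XYZ]
  have YY: "((\<lambda>x. Y x * Y x) has_sum A) UNIV"
    by (subst has_sum_Suc_fst) (use XX in \<open>auto simp: XYZ shift1_def case_prod_unfold\<close>)
  have ZZ: "((\<lambda>x. Z x * Z x) has_sum A) UNIV"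
    by (subst has_sum_Suc_snd) (use XX in \<open>auto simp: XYZ shift2_def case_prod_unfold\<close>)
  have at0: "X (0, 0) = 1" "Y (0, 0) = 0" "Z (0, 0) = 0" "e (0, 0) = 1"
    by (simp_all add: XYZ e_def a00 shift1_def shift2_def unit2_def)
  have e_nz: "e x = 0" if "x \<noteq> (0, 0)" for x
    using that by (simp add: e_def unit2_def)
  have e: "((\<lambda>x. e x * V x) has_sum V (0, 0)) UNIV" for V :: "nat \<times> nat \<Rightarrow> real"
    by (rule has_sum_finite_neutralI[of "{(0, 0)}"]) (use e_nz at0 in auto)

  have quad: "((\<lambda>x. (s * X x + t * Y x + u * Z x)\<^sup>2) has_sum
      ((s\<^sup>2 + t\<^sup>2 + u\<^sup>2) * A + 2 * s * (t + u) * B + 2 * t * u * C)) UNIV" for s t u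
  proof -
    have "((\<lambda>x. (s\<^sup>2 * (X x * X x) + t\<^sup>2 * (Y x * Y x) + u\<^sup>2 * (Z x * Z x)) +
                (2 * s * t * (X x * Y x) + 2 * s * u * (X x * Z x) + 2 * t * u * (Y x * Z x))) has_sum
          ((s\<^sup>2 * A + t\<^sup>2 * A + u\<^sup>2 * A) + (2 * s * t * B + 2 * s * u * B + 2 * t * u * C))) UNIV"
      by (intro has_sum_add has_sum_cmult_right XX YY ZZ XY XZ YZ)
    then show ?thesis
      by (simp add: algebra_simps power2_eq_square)
  qed

  have "A \<ge> 1"
    using finite_sum_le_has_sum[OF XX, of "{(0, 0)}"] at0 by simp
  with \<open>C \<ge> 0\<close> have AC: "A + C > 0" by simp
  \<comment> \<open>Orthogonality to \<open>Y\<close> and \<open>Z\<close> forces this ratio of each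
    linear coefficient to the constant one.\<close>
  define t where "t = - B / (A + C)"
  have tAC: "t * (A + C) = - B"
    using AC by (simp add: t_def)
  \<comment> \<open>\<open>D\<close> is both the squared norm of \<open>X + t Y + t Z\<close> and
    its inner product with \<open>X\<close>. Its coefficient 1 at \<open>(0, 0)\<close> gives
    \<open>D \<ge> 1\<close>, and the factor \<open>1 / D\<close> then makes the residual orthogonal
    to \<open>X\<close>.\<close>
  define D where "D = A + 2 * t * B"
  have "((\<lambda>x. (1 * X x + t * Y x + t * Z x)\<^sup>2) has_sum D) UNIV"
  proof -
    have "(1\<^sup>2 + t\<^sup>2 + t\<^sup>2) * A + 2 * 1 * (t + t) * B + 2 * t * t * C =
        A + 4 * t * B + 2 * t * (t * (A + C))"
      by (simp add: algebra_simps power2_eq_square)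
    also have "\<dots> = D"
      unfolding tAC by (simp add: D_def)
    finally show ?thesis
      using quad[of 1 t t] by simp
  qed
  from finite_sum_le_has_sum[OF this, of "{(0, 0)}"] have "D \<ge> 1"
    by (simp add: at0)
  define \<alpha> where "\<alpha> = 1 / D"
  define \<beta> where "\<beta> = \<alpha> * t"
  have \<alpha>D: "\<alpha> * D = 1"
    using \<open>D \<ge> 1\<close> by (simp add: \<alpha>_def)

  define r where "r = (\<lambda>x. e x - (\<alpha> * X x + \<beta> * Y x + \<beta> * Z x))"
  have rX: "((\<lambda>x. r x * X x) has_sum 0) UNIV"
  proof -
    have "((\<lambda>x. e x * X x - (\<alpha> * (X x * X x) + \<beta> * (X x * Y x) + \<beta> * (X x * Z x))) has_sum
        (X (0, 0) - (\<alpha> * A + \<beta> * B + \<beta> * B))) UNIV"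
      by (intro has_sum_diff has_sum_add has_sum_cmult_right e XX XY XZ)
    moreover have "X (0, 0) - (\<alpha> * A + \<beta> * B + \<beta> * B) = 0"
      using \<alpha>D by (simp add: at0 \<beta>_def D_def algebra_simps)
    ultimately show ?thesis
      by (simp add: r_def algebra_simps)
  qed
  have normal: "\<alpha> * B + \<beta> * A + \<beta> * C = 0"
  proof -
    have "\<alpha> * B + \<beta> * A + \<beta> * C = \<alpha> * (B + t * (A + C))"
      by (simp add: \<beta>_def algebra_simps)
    then show ?thesis by (simp add: tAC)
  qed
  have rY: "((\<lambda>x. r x * Y x) has_sum 0) UNIV"
  proof -
    have "((\<lambda>x. e x * Y x - (\<alpha> * (X x * Y x) + \<beta> * (Y x * Y x) + \<beta> * (Y x * Z x))) has_sum
        (Y (0, 0) - (\<alpha> * B + \<beta> * A + \<beta> * C))) UNIV"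
      by (intro has_sum_diff has_sum_add has_sum_cmult_right e YY XY YZ)
    then show ?thesis
      unfolding normal by (simp add: r_def at0 algebra_simps)
  qed
  have rZ: "((\<lambda>x. r x * Z x) has_sum 0) UNIV"
  proof -
    have "((\<lambda>x. e x * Z x - (\<alpha> * (X x * Z x) + \<beta> * (Z x * Z x) + \<beta> * (Y x * Z x))) has_sum
        (Z (0, 0) - (\<alpha> * B + \<beta> * A + \<beta> * C))) UNIV"
      by (intro has_sum_diff has_sum_add has_sum_cmult_right e ZZ XZ YZ)
    then show ?thesis
      unfolding normal by (simp add: r_def at0 algebra_simps)
  qed
  \<comment> \<open>Since \<open>r\<close> is orthogonal to \<open>X\<close>, \<open>Y\<close> and
    \<open>Z\<close>, its squared norm is its inner product with \<open>e\<close>, which reads off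
    the coefficient at \<open>(0, 0)\<close>.\<close>
  have rr: "((\<lambda>x. (r x)\<^sup>2) has_sum r (0, 0)) UNIV"
  proof -
    have "((\<lambda>x. e x * r x - (\<alpha> * (r x * X x) + \<beta> * (r x * Y x) + \<beta> * (r x * Z x))) has_sum
        (r (0, 0) - (\<alpha> * 0 + \<beta> * 0 + \<beta> * 0))) UNIV"
      by (intro has_sum_diff has_sum_add has_sum_cmult_right e rX rY rZ)
    moreover have "e x * r x - (\<alpha> * (r x * X x) + \<beta> * (r x * Y x) + \<beta> * (r x * Z x)) = (r x)\<^sup>2" for x
      by (simp add: r_def algebra_simps power2_eq_square)
    ultimately show ?thesis by simp
  qed

  define v where "v = (\<lambda>x' y' z' x. x' * of_real (X x) + y' * of_real (Y x) + z' * complex_of_real (Z x))"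
  define N where "N = (\<lambda>x' y' z'. \<Sum>\<^sub>\<infinity>x. (cmod (v x' y' z' x))\<^sup>2)"
  have N: "((\<lambda>x. (cmod (v x' y' z' x))\<^sup>2) has_sum N x' y' z') UNIV" for x' y' z'
  proof -
    have eq: "(cmod (v x' y' z' x))\<^sup>2 =
        (Re x' * X x + Re y' * Y x + Re z' * Z x)\<^sup>2 + (Im x' * X x + Im y' * Y x + Im z' * Z x)\<^sup>2" for x
      by (simp add: v_def cmod_power2)
    have "(\<lambda>x. (cmod (v x' y' z' x))\<^sup>2) summable_on UNIV"
      unfolding eq by (rule has_sum_imp_summable[OF has_sum_add[OF quad quad]])
    then show ?thesis
      unfolding N_def by (rule has_sum_infsum)
  qed
  have N_0: "N 0 0 0 = 0"
    by (simp add: N_def v_def)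
  have N_pos: "N x' y' z' > 0" if "x' \<noteq> 0 \<or> y' \<noteq> 0 \<or> z' \<noteq> 0" for x' y' z'
  proof (rule ccontr)
    assume "\<not> N x' y' z' > 0"
    then have v0: "v x' y' z' x = 0" for x
      using nonneg_has_sum_le_0D[OF N, of x' y' z' x] by simp
    \<comment> \<open>Linear independence: at \<open>(0, 0)\<close>, \<open>(1, 0)\<close>,
      \<open>(0, 1)\<close> the values of the three arrays form a unit triangular matrix.\<close>
    from v0[of "(0, 0)"] have "x' = 0"
      by (simp add: v_def at0)
    with v0[of "(1, 0)"] v0[of "(0, 1)"] have "y' = 0" "z' = 0"
      by (simp_all add: v_def XYZ a00 shift1_def shift2_def)
    with \<open>x' = 0\<close> that show False by simp
  qed

  define q where "q = (\<lambda>\<alpha>' \<beta>' \<gamma>' (z1 :: complex, z2 :: complex). \<alpha>' + \<beta>' * z1 + \<gamma>' * z2 :: complex)"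
  have norm_q: "hardy2_norm (\<lambda>z. 1 - q \<alpha>' \<beta>' \<gamma>' z * f z) =
      sqrt (r (0, 0) + N (of_real \<alpha> - \<alpha>') (of_real \<beta> - \<beta>') (of_real \<beta> - \<gamma>'))" for \<alpha>' \<beta>' \<gamma>'
  proof -
    let ?x = "of_real \<alpha> - \<alpha>'" and ?y = "of_real \<beta> - \<beta>'" and ?z = "of_real \<beta> - \<gamma>'"
    let ?R = "residual (\<lambda>x. complex_of_real (a x)) \<alpha>' \<beta>' \<gamma>'"
    have "?R x = of_real (r x) + v ?x ?y ?z x" for x
      by (cases x) (simp add: residual_def r_def v_def XYZ e_def shift1_def shift2_def unit2_def algebra_simps)
    \<comment> \<open>As \<open>r\<close> is real, the cross term involves only the real parts of
      the coefficients, and it sums to 0 by orthogonality.\<close>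
    then have "(cmod (?R x))\<^sup>2 = (r x)\<^sup>2 + (cmod (v ?x ?y ?z x))\<^sup>2 +
        (2 * Re ?x * (r x * X x) + 2 * Re ?y * (r x * Y x) + 2 * Re ?z * (r x * Z x))" for x
      by (simp add: cmod_power2 v_def) (simp add: algebra_simps power2_eq_square)
    moreover have "((\<lambda>x. (r x)\<^sup>2 + (cmod (v ?x ?y ?z x))\<^sup>2 +
        (2 * Re ?x * (r x * X x) + 2 * Re ?y * (r x * Y x) + 2 * Re ?z * (r x * Z x))) has_sum
        (r (0, 0) + N ?x ?y ?z + (2 * Re ?x * 0 + 2 * Re ?y * 0 + 2 * Re ?z * 0))) UNIV"
      by (intro has_sum_add has_sum_cmult_right rr N rX rY rZ)
    ultimately have "(\<Sum>\<^sub>\<infinity>x. (cmod (?R x))\<^sup>2) = r (0, 0) + N ?x ?y ?z"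
      by (simp add: infsumI)
    then show ?thesis
      unfolding q_def by (subst hardy2_norm_residual[OF f(2)]) simp
  qed
  have poly2: "poly2_deg1 = {p. \<exists>\<alpha>' \<beta>' \<gamma>'. p = q \<alpha>' \<beta>' \<gamma>'}"
    by (simp add: poly2_deg1_def q_def)
  define p0 where "p0 = q (of_real \<alpha>) (of_real \<beta>) (of_real \<beta>)"
  have "is_opa1 f p \<longleftrightarrow> p = p0" for p
  proof
    assume p: "is_opa1 f p"
    then obtain \<alpha>' \<beta>' \<gamma>' where p_eq: "p = q \<alpha>' \<beta>' \<gamma>'"
      by (auto simp: is_opa1_def poly2)
    have "p0 \<in> poly2_deg1"
      by (auto simp: p0_def poly2)
    with p have "hardy2_norm (\<lambda>z. 1 - p z * f z) \<le> hardy2_norm (\<lambda>z. 1 - p0 z * f z)"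
      by (auto simp: is_opa1_def)
    then have "N (of_real \<alpha> - \<alpha>') (of_real \<beta> - \<beta>') (of_real \<beta> - \<gamma>') \<le> 0"
      by (simp add: p_eq p0_def norm_q N_0)
    then have "\<alpha>' = of_real \<alpha>" "\<beta>' = of_real \<beta>" "\<gamma>' = of_real \<beta>"
      using N_pos[of "of_real \<alpha> - \<alpha>'" "of_real \<beta> - \<beta>'" "of_real \<beta> - \<gamma>'"] by auto
    then show "p = p0"
      by (simp add: p_eq p0_def)
  next
    assume "p = p0"
    have "N x' y' z' \<ge> 0" for x' y' z'
      using N_pos[of x' y' z'] N_0 by (cases "x' = 0 \<and> y' = 0 \<and> z' = 0") auto
    with \<open>p = p0\<close> f(1) show "is_opa1 f p"
      by (auto simp: is_opa1_def poly2 p0_def norm_q N_0)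
  qed
  moreover have "\<beta> = - \<alpha> * B / (A + C)"
    by (simp add: \<beta>_def t_def)
  ultimately show ?thesis
    using that[of \<alpha>] by (simp add: p0_def q_def)
qed

section \<open>Positivity of the series\<close>

text \<open>The coefficient of \<open>u ^ n\<close> in
  \<open>(1 - u) powr (- (5 / 2))\<close>.\<close>

definition ser_coeff :: "nat \<Rightarrow> real" where
  "ser_coeff n = pochhammer (5 / 2) n / fact n"

lemma ser_coeff_0 [simp]: "ser_coeff 0 = 1"
  by (simp add: ser_coeff_def)

lemma ser_coeff_Suc: "ser_coeff (Suc n) = ser_coeff n * ((real n + 5 / 2) / (real n + 1))"
  by (simp add: ser_coeff_def pochhammer_Suc field_simps)

lemma ser_coeff_pos [simp]: "ser_coeff n > 0"
  by (simp add: ser_coeff_def pochhammer_pos)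

text \<open>With \<open>A\<close>, \<open>B\<close>, \<open>C\<close> the Gram entries of \<open>f, z\<^sub>1f, z\<^sub>2f\<close>, the degree-\<open>n\<close> parts
  of \<open>A + C\<close> and \<open>2B\<close> are \<open>gram_weight n\<close> and \<open>gram_weight n * (gram_factor n + 1)\<close>.\<close>

definition gram_weight :: "nat \<Rightarrow> real" where
  "gram_weight n = (ser_coeff n)\<^sup>2 / 6 ^ n * real (Suc (2 * n) choose n)"

lemma gram_weight_0: "gram_weight 0 = 1"
  by (simp add: gram_weight_def)

lemma gram_weight_nonneg: "gram_weight n \<ge> 0"
  by (simp add: gram_weight_def)

lemma central_binomial_Suc:
  "(real n + 2) * real (Suc (2 * Suc n) choose Suc n) =
     2 * (2 * real n + 3) * real (Suc (2 * n) choose n)"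
proof -
  have 1: "real (Suc (2 * n) choose n) = fact (2 * n + 1) / (fact n * fact (n + 1))"
    by (subst binomial_fact) simp_all
  have 2: "real (Suc (2 * Suc n) choose Suc n) = fact (2 * n + 3) / (fact (n + 1) * fact (n + 2))"
    by (subst binomial_fact) (simp_all add: numeral_3_eq_3)
  have 3: "(fact (2 * n + 3) :: real) = (2 * real n + 3) * (2 * real n + 2) * fact (2 * n + 1)"
    by (simp add: eval_nat_numeral algebra_simps)
  have 4: "(fact (n + 2) :: real) = (real n + 2) * (real n + 1) * fact n"
    by (simp add: eval_nat_numeral algebra_simps)
  show ?thesis
    unfolding 1 2 3 4 by (simp add: divide_simps) (simp add: algebra_simps)
qed

text \<open>The ratio tends to 2/3, so the weights eventually decay geometrically.\<close>

lemma gram_weight_Suc: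
  "gram_weight (Suc n) = gram_weight n * (((real n + 5 / 2) / (real n + 1))\<^sup>2 * (2 * real n + 3) / (3 * (real n + 2)))"
proof -
  have 1: "real (Suc (2 * Suc n) choose Suc n) =
      2 * (2 * real n + 3) / (real n + 2) * real (Suc (2 * n) choose n)"
    using central_binomial_Suc[of n] by (simp add: field_simps)
  have "(ser_coeff n * q)\<^sup>2 / 6 ^ Suc n * (2 * (2 * real n + 3) / (real n + 2) * b) =
      (ser_coeff n)\<^sup>2 / 6 ^ n * b * (q\<^sup>2 * (2 * real n + 3) / (3 * (real n + 2)))" for q b
    by (simp add: power_mult_distrib divide_simps) (simp add: algebra_simps)
  then show ?thesis
    unfolding gram_weight_def 1 ser_coeff_Suc .
qed

text \<open>The recurrence indexed by its target, so that it rewrites weights at numerals.\<close>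

lemma gram_weight_rec:
  "n > 0 \<Longrightarrow> gram_weight n = gram_weight (n - 1) *
     (((real n + 3 / 2) / real n)\<^sup>2 * (2 * real n + 1) / (3 * (real n + 1)))"
  by (cases n) (simp_all add: gram_weight_Suc algebra_simps)

text \<open>The index 12 is the first at which the ratio of consecutive weights is below
  4/5.\<close>

lemma gram_weight_ratio_le:
  assumes "n \<ge> 12"
  shows "gram_weight (Suc n) \<le> 4 / 5 * gram_weight n"
proof -
  obtain m where m: "real n = 12 + real m"
    using assms by (metis le_Suc_ex of_nat_add of_nat_numeral)
  \<comment> \<open>With \<open>n = 12 + m\<close> and denominators cleared, every coefficient in
    \<open>m\<close> has the right sign.\<close>
  have "((real n + 5 / 2) / (real n + 1))\<^sup>2 * (2 * real n + 3) / (3 * (real n + 2)) \<le> 4 / 5"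
    unfolding m by (simp add: power_divide divide_simps) (simp add: power2_eq_square algebra_simps)
  then have "gram_weight n * (((real n + 5 / 2) / (real n + 1))\<^sup>2 * (2 * real n + 3) / (3 * (real n + 2)))
      \<le> gram_weight n * (4 / 5)"
    by (intro mult_left_mono gram_weight_nonneg)
  then show ?thesis
    by (simp add: gram_weight_Suc)
qed

lemma summable_gram_weight: "summable gram_weight"
  by (rule summable_ratio_test[of "4 / 5" 12]) (use gram_weight_ratio_le gram_weight_nonneg in auto)

text \<open>Decreasing in \<open>n\<close> with limit \<open>2 / sqrt 6 - 1 < 0\<close>: positive up
  to \<open>n = 5\<close>, negative from 6 on. Positivity of the weighted series is therefore a
  quantitative matter.\<close>

definition gram_factor :: "nat \<Rightarrow> real" where
  "gram_factor n = 2 / sqrt 6 * ((real n + 5 / 2) / (real n + 1)) - 1"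

text \<open>0.816 lies just below \<open>2 / sqrt 6\<close> and makes the finite computation
  rational.\<close>

definition gram_factor_lb :: "nat \<Rightarrow> real" where
  "gram_factor_lb n = 0.816 * ((real n + 5 / 2) / (real n + 1)) - 1"

lemma gram_factor_lb_le: "gram_factor_lb n \<le> gram_factor n"
proof -
  have "sqrt 6 \<le> 2 / 0.816"
    by (rule real_le_lsqrt) (simp_all add: power2_eq_square)
  then have "0.816 \<le> 2 / sqrt 6"
    by (simp add: field_simps)
  then show ?thesis
    unfolding gram_factor_def gram_factor_lb_def by (intro diff_mono mult_right_mono) auto
qed

text \<open>Keeping the next weight on the right-hand side makes the bound inductive: from 12 on it
  pays for the negative terms, since the weights shrink by 4/5 while the factors stay above -1/5.\<close>

lemma weight_factor_partial_sum_ge: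
  assumes "n \<ge> 12"
  shows "(\<Sum>k<n. gram_weight k * gram_factor_lb k) \<ge> gram_weight n + 1 / 10"
  using assms
proof (induction n rule: dec_induct)
  case base
  \<comment> \<open>Exact weights turn the base case into rational arithmetic: the partial sum is
    about 3.45, and \<open>gram_weight 12\<close> about 3.14.\<close>
  have w1: "gram_weight (Suc 0) = 25 / 8"
    by (subst gram_weight_rec) (simp_all add: gram_weight_0 power2_eq_square)
  have w2: "gram_weight 2 = 6125 / 1152"
    by (subst gram_weight_rec) (simp_all add: w1 power2_eq_square)
  have w3: "gram_weight 3 = 42875 / 6144"
    by (subst gram_weight_rec) (simp_all add: w2 power2_eq_square)
  have w4: "gram_weight 4 = 1037575 / 131072"
    by (subst gram_weight_rec) (simp_all add: w3 power2_eq_square)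
  have w5: "gram_weight 5 = 77154077 / 9437184"
    by (subst gram_weight_rec) (simp_all add: w4 power2_eq_square)
  have w6: "gram_weight 6 = 3582153575 / 452984832"
    by (subst gram_weight_rec) (simp_all add: w5 power2_eq_square)
  have w7: "gram_weight 7 = 105636977875 / 14495514624"
    by (subst gram_weight_rec) (simp_all add: w6 power2_eq_square)
  have w8: "gram_weight 8 = 648294133218875 / 100192997081088"
    by (subst gram_weight_rec) (simp_all add: w7 power2_eq_square)
  have w9: "gram_weight 9 = 120712367605354525 / 21641687369515008"
    by (subst gram_weight_rec) (simp_all add: w8 power2_eq_square)
  have w10: "gram_weight 10 = 1625446899064101113 / 346266997912240128"
    by (subst gram_weight_rec) (simp_all add: w9 power2_eq_square)
  have w11: "gram_weight 11 = 193105778297904574375 / 49862447699362578432"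
    by (subst gram_weight_rec) (simp_all add: w10 power2_eq_square)
  have w12: "gram_weight 12 = 371357265957508796875 / 118192468620711297024"
    by (subst gram_weight_rec) (simp_all add: w11 power2_eq_square)
  have "{..<12} = {0, 1, 2, 3, 4, 5, 6, 7, 8, 9, 10, 11 :: nat}"
    by (rule set_eqI, simp, presburger)
  then show ?case
    by (simp add: gram_factor_lb_def gram_weight_0 w1 w2 w3 w4 w5 w6 w7 w8 w9 w10 w11 w12)
next
  case (step n)
  have "gram_factor_lb n \<ge> - 1 / 5"
    by (simp add: gram_factor_lb_def field_simps)
  then have "gram_weight n * gram_factor_lb n \<ge> gram_weight n * (- 1 / 5)"
    by (intro mult_left_mono gram_weight_nonneg)
  with step gram_weight_ratio_le[of n] show ?case
    by simp
qed

text \<open>The uniform margin 1/10 of the partial sums survives the limit and keeps the inequality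
  strict.\<close>

lemma suminf_weight_factor_pos:
  assumes "summable (\<lambda>n. gram_weight n * gram_factor n)"
  shows "(\<Sum>n. gram_weight n * gram_factor n) > 0"
proof -
  have "(\<lambda>n. \<Sum>k<n. gram_weight k * gram_factor k) \<longlonglongrightarrow> (\<Sum>n. gram_weight n * gram_factor n)"
    using summable_LIMSEQ[OF assms] .
  moreover have "1 / 10 \<le> (\<Sum>k<n. gram_weight k * gram_factor k)" if "n \<ge> 12" for n
  proof -
    have "1 / 10 \<le> (\<Sum>k<n. gram_weight k * gram_factor_lb k)"
      using weight_factor_partial_sum_ge[OF that] gram_weight_nonneg[of n] by simp
    also have "\<dots> \<le> (\<Sum>k<n. gram_weight k * gram_factor k)"
      by (intro sum_mono mult_left_mono gram_factor_lb_le gram_weight_nonneg)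
    finally show ?thesis .
  qed
  ultimately have "1 / 10 \<le> (\<Sum>n. gram_weight n * gram_factor n)"
    by (intro LIMSEQ_le_const) auto
  then show ?thesis by simp
qed

section \<open>The function and its Gram matrix\<close>

text \<open>Bridge to Newton's binomial series, used over the complex numbers for the values of
  \<open>f\<close> and over the reals for absolute convergence.\<close>

lemma ser_coeff_eq_gbinomial:
  "(of_real (ser_coeff n) :: 'a :: {real_normed_field}) = ((- (5 / 2)) gchoose n) * (- 1) ^ n"
proof -
  have "(of_real (ser_coeff n) :: 'a) = pochhammer (of_real (5 / 2)) n / fact n"
    unfolding ser_coeff_def of_real_divide pochhammer_of_real[symmetric] by simp
  then show ?thesis
    by (simp add: gbinomial_pochhammer flip: power_mult_distrib)
qed

lemma ser_coeff_power_series: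
  assumes "norm (u :: complex) < 1"
  shows "(\<lambda>n. of_real (ser_coeff n) * u ^ n) sums ((1 - u) powr (- (5 / 2)))"
proof -
  have "(\<lambda>n. ((- (5 / 2)) gchoose n) * (- u) ^ n) sums ((1 + (- u)) powr (- (5 / 2)))"
    by (rule gen_binomial_complex) (use assms in simp)
  moreover have "((- (5 / 2)) gchoose n) * (- u) ^ n = of_real (ser_coeff n) * u ^ n" for n
    by (simp add: ser_coeff_eq_gbinomial power_minus[of u] mult_ac)
  ultimately show ?thesis by simp
qed

lemma summable_ser_coeff_power:
  assumes "\<bar>x\<bar> < 1"
  shows "summable (\<lambda>n. ser_coeff n * x ^ n)"
proof -
  have "(\<lambda>n. ((- (5 / 2)) gchoose n) * (- x) ^ n) sums ((1 + (- x)) powr (- (5 / 2)))"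
    by (rule gen_binomial_real) (use assms in simp)
  moreover have "((- (5 / 2)) gchoose n) * (- x) ^ n = ser_coeff n * x ^ n" for n
    using ser_coeff_eq_gbinomial[of n, where 'a = real] by (simp add: power_minus[of x] mult_ac)
  ultimately show ?thesis by (simp add: sums_iff)
qed

text \<open>Taylor coefficients of \<open>f\<close>: the term of degree \<open>k + l\<close> of the
  binomial series, with the power of \<open>z1 + z2\<close> expanded.\<close>

definition coeff_f :: "nat \<times> nat \<Rightarrow> real" where
  "coeff_f = (\<lambda>(k, l). ser_coeff (k + l) * real ((k + l) choose k) / sqrt 6 ^ (k + l))"

lemma coeff_f_nonneg: "coeff_f x \<ge> 0"
  by (simp add: coeff_f_def case_prod_unfold less_imp_le)

lemma coeff_f_swap: "coeff_f (l, k) = coeff_f (k, l)"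
  using binomial_symmetric[of k "k + l"] by (simp add: coeff_f_def add.commute)

text \<open>The binomial theorem in degree \<open>n\<close>, over a general field so that it applies
  to \<open>z1\<close>, \<open>z2\<close> and to their norms.\<close>

lemma coeff_f_diagonal:
  fixes z1 z2 :: "'a :: real_normed_field"
  shows "(\<Sum>k\<le>n. of_real (coeff_f (k, n - k)) * z1 ^ k * z2 ^ (n - k)) =
    of_real (ser_coeff n) * ((z1 + z2) / of_real (sqrt 6)) ^ n"
proof -
  have "(\<Sum>k\<le>n. of_real (coeff_f (k, n - k)) * z1 ^ k * z2 ^ (n - k)) =
    (\<Sum>k\<le>n. of_real (ser_coeff n) / of_real (sqrt 6) ^ n * (of_nat (n choose k) * z1 ^ k * z2 ^ (n - k)))"
    by (intro sum.cong) (simp_all add: coeff_f_def)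
  also have "\<dots> = of_real (ser_coeff n) / of_real (sqrt 6) ^ n * (z1 + z2) ^ n"
    by (simp only: binomial_ring sum_distrib_left)
  finally show ?thesis
    by (simp add: power_divide)
qed

lemma sqrt6_gt_2: "sqrt 6 > 2"
  by (rule real_less_rsqrt) simp

text \<open>On the bidisc \<open>norm z1 + norm z2 < 2 < sqrt 6\<close>, so the binomial series
  still converges absolutely after each power of \<open>z1 + z2\<close> is expanded.\<close>

lemma expands_coeff_f:
  "expands_on_bidisc (\<lambda>x. of_real (coeff_f x))
     (\<lambda>(z1, z2). (1 - (z1 + z2) / of_real (sqrt 6)) powr (- (5 / 2)))"
proof (rule expands_on_bidiscI)
  fix z1 z2 :: complex assume z: "norm z1 < 1" "norm z2 < 1"
  define F where "F = (\<lambda>(k, l). of_real (coeff_f (k, l)) * z1 ^ k * z2 ^ l)"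
  define u where "u = (z1 + z2) / complex_of_real (sqrt 6)"
  have lt: "norm z1 + norm z2 < sqrt 6"
    using z sqrt6_gt_2 by linarith
  have u: "norm u < 1"
    using norm_triangle_ineq[of z1 z2] lt by (simp add: u_def norm_divide)
  have "(\<Sum>k\<le>n. norm (F (k, n - k))) = ser_coeff n * ((norm z1 + norm z2) / sqrt 6) ^ n" for n
    using coeff_f_diagonal[of n "norm z1" "norm z2"]
    by (simp add: F_def norm_mult norm_power coeff_f_nonneg)
  moreover have "summable (\<lambda>n. ser_coeff n * ((norm z1 + norm z2) / sqrt 6) ^ n)"
    by (rule summable_ser_coeff_power) (use lt in simp)
  ultimately have "(F has_sum (\<Sum>n. \<Sum>k\<le>n. F (k, n - k))) UNIV"
    by (intro has_sum_diagonal) simp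
  moreover have "(\<Sum>k\<le>n. F (k, n - k)) = of_real (ser_coeff n) * u ^ n" for n
    using coeff_f_diagonal[of n z1 z2] by (simp add: F_def u_def)
  ultimately have "(F has_sum ((1 - u) powr (- (5 / 2)))) UNIV"
    using ser_coeff_power_series[OF u] by (simp add: sums_iff)
  then show "((\<lambda>(k, l). complex_of_real (coeff_f (k, l)) * z1 ^ k * z2 ^ l) has_sum
      (case (z1, z2) of (z1, z2) \<Rightarrow> (1 - (z1 + z2) / of_real (sqrt 6)) powr (- (5 / 2)))) UNIV"
    by (simp add: F_def u_def)
qed

text \<open>The function depends on \<open>z1 + z2\<close> only, and the base of the power has
  positive real part, which keeps it off the branch cut.\<close>

lemma holomorphic_f:
  "holomorphic_on_bidisc (\<lambda>(z1, z2). (1 - (z1 + z2) / of_real (sqrt 6)) powr (- (5 / 2)))"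
  unfolding holomorphic_on_bidisc_def
proof
  fix z assume "z \<in> bidisc"
  then obtain z1 z2 where z: "z = (z1, z2)" "norm z1 < 1" "norm z2 < 1"
    by (cases z) auto
  define g where "g = (\<lambda>u. (1 - u / complex_of_real (sqrt 6)) powr (- (5 / 2)))"
  have "norm ((z1 + z2) / complex_of_real (sqrt 6)) < 1"
    using norm_triangle_ineq[of z1 z2] z sqrt6_gt_2 by (simp add: norm_divide)
  then have "Re ((z1 + z2) / complex_of_real (sqrt 6)) < 1"
    using complex_Re_le_cmod order_le_less_trans by blast
  then have "1 - (z1 + z2) / complex_of_real (sqrt 6) \<notin> \<real>\<^sub>\<le>\<^sub>0"
    by (auto simp: complex_nonpos_Reals_iff)
  then have "g field_differentiable at (z1 + z2)"
    unfolding g_def field_differentiable_def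
    by (intro exI, rule DERIV_chain2[OF has_field_derivative_powr])
       (auto intro!: derivative_eq_intros)
  then obtain D where "(g has_derivative (*) D) (at (z1 + z2))"
    by (auto simp: field_differentiable_def has_field_derivative_def)
  then have "((\<lambda>x. g (fst x + snd x)) has_derivative (\<lambda>h. D * (fst h + snd h))) (at z)"
    by (intro has_derivative_compose[of "\<lambda>x. fst x + snd x" _ z UNIV g])
       (auto intro!: derivative_eq_intros simp: z)
  then have "((\<lambda>(z1, z2). (1 - (z1 + z2) / of_real (sqrt 6)) powr (- (5 / 2))) has_derivative
      (\<lambda>(h1, h2). D * h1 + D * h2)) (at z)"
    by (simp add: g_def case_prod_unfold distrib_left)
  then show "\<exists>a b. ((\<lambda>(z1, z2). (1 - (z1 + z2) / of_real (sqrt 6)) powr (- (5 / 2))) has_derivative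
      (\<lambda>(h1, h2). a * h1 + b * h2)) (at z)"
    by blast
qed

text \<open>Diagonal contributions to the Gram entries. Because of the shifts,
  \<open>gram_B n\<close> pairs degree \<open>n\<close> with degree \<open>n + 1\<close>, and
  \<open>gram_C n\<close> pairs coefficients of degree \<open>n + 1\<close>.\<close>

definition gram_A :: "nat \<Rightarrow> real" where
  "gram_A n = (ser_coeff n)\<^sup>2 / 6 ^ n * real ((2 * n) choose n)"

definition gram_B :: "nat \<Rightarrow> real" where
  "gram_B n = ser_coeff n * ser_coeff (Suc n) / sqrt 6 ^ Suc (2 * n) * real (Suc (2 * n) choose n)"

definition gram_C :: "nat \<Rightarrow> real" where
  "gram_C n = (ser_coeff (Suc n))\<^sup>2 / 6 ^ Suc n * real ((2 * Suc n) choose n)"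

lemma sqrt6_power: "sqrt 6 ^ (2 * n) = 6 ^ n" "sqrt 6 ^ n * sqrt 6 ^ n = 6 ^ n"
  by (simp_all add: power_mult flip: power_mult_distrib)

lemma gram_A_diagonal: "(\<Sum>k\<le>n. coeff_f (k, n - k) * coeff_f (k, n - k)) = gram_A n"
proof -
  have "(\<Sum>k\<le>n. coeff_f (k, n - k) * coeff_f (k, n - k)) =
      (\<Sum>k\<le>n. (ser_coeff n)\<^sup>2 / 6 ^ n * real ((n choose k)\<^sup>2))"
    by (intro sum.cong) (simp_all add: coeff_f_def power2_eq_square sqrt6_power)
  also have "\<dots> = (ser_coeff n)\<^sup>2 / 6 ^ n * real (\<Sum>k\<le>n. (n choose k)\<^sup>2)"
    by (simp only: sum_distrib_left of_nat_sum)
  also have "\<dots> = gram_A n"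
    by (simp only: choose_square_sum gram_A_def)
  finally show ?thesis .
qed

text \<open>Reflecting \<open>Suc n choose Suc k\<close> into \<open>Suc n choose (n - k)\<close>
  brings the sum into Vandermonde form.\<close>

lemma gram_B_diagonal: "(\<Sum>k\<le>n. coeff_f (k, n - k) * coeff_f (Suc k, n - k)) = gram_B n"
proof -
  have pow: "sqrt 6 ^ Suc (2 * n) = sqrt 6 ^ n * sqrt 6 ^ Suc n"
    by (simp add: mult_2 power_add)
  have "coeff_f (k, n - k) * coeff_f (Suc k, n - k) =
      ser_coeff n * ser_coeff (Suc n) / sqrt 6 ^ Suc (2 * n) * real ((n choose k) * (Suc n choose (n - k)))"
    if "k \<le> n" for k
    using that binomial_symmetric[of "Suc k" "Suc n"] unfolding pow
    by (simp add: coeff_f_def del: binomial_Suc_Suc)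
  then have "(\<Sum>k\<le>n. coeff_f (k, n - k) * coeff_f (Suc k, n - k)) =
      (\<Sum>k\<le>n. ser_coeff n * ser_coeff (Suc n) / sqrt 6 ^ Suc (2 * n) * real ((n choose k) * (Suc n choose (n - k))))"
    by (intro sum.cong) auto
  also have "\<dots> = ser_coeff n * ser_coeff (Suc n) / sqrt 6 ^ Suc (2 * n) *
      real (\<Sum>k\<le>n. (n choose k) * (Suc n choose (n - k)))"
    by (simp only: sum_distrib_left of_nat_sum)
  also have "\<dots> = gram_B n"
    by (simp only: vandermonde gram_B_def) (simp add: mult_2)
  finally show ?thesis .
qed

text \<open>Vandermonde with both upper indices \<open>Suc n\<close>, after the same reflection of
  one binomial.\<close>

lemma gram_C_diagonal: "(\<Sum>k\<le>n. coeff_f (k, Suc (n - k)) * coeff_f (Suc k, n - k)) = gram_C n"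
proof -
  have "coeff_f (k, Suc (n - k)) * coeff_f (Suc k, n - k) =
      (ser_coeff (Suc n))\<^sup>2 / 6 ^ Suc n * real ((Suc n choose k) * (Suc n choose (n - k)))"
    if "k \<le> n" for k
    using that binomial_symmetric[of "Suc k" "Suc n"] sqrt6_power(2)[of "Suc n"]
    by (simp add: coeff_f_def power2_eq_square del: binomial_Suc_Suc)
  then have "(\<Sum>k\<le>n. coeff_f (k, Suc (n - k)) * coeff_f (Suc k, n - k)) =
      (\<Sum>k\<le>n. (ser_coeff (Suc n))\<^sup>2 / 6 ^ Suc n * real ((Suc n choose k) * (Suc n choose (n - k))))"
    by (intro sum.cong) auto
  also have "\<dots> = (ser_coeff (Suc n))\<^sup>2 / 6 ^ Suc n * real (\<Sum>k\<le>n. (Suc n choose k) * (Suc n choose (n - k)))"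
    by (simp only: sum_distrib_left of_nat_sum)
  also have "\<dots> = gram_C n"
    by (simp only: vandermonde gram_C_def) (simp add: mult_2)
  finally show ?thesis .
qed

lemma gram_nonneg: "gram_A n \<ge> 0" "gram_B n \<ge> 0" "gram_C n \<ge> 0"
  by (simp_all add: gram_A_def gram_B_def gram_C_def less_imp_le)

lemma gram_weight_0_eq: "gram_weight 0 = gram_A 0"
  by (simp add: gram_weight_0 gram_A_def)

text \<open>Pascal's rule for \<open>Suc (2 * Suc n) choose Suc n\<close>.\<close>

lemma gram_weight_Suc_eq: "gram_weight (Suc n) = gram_A (Suc n) + gram_C n"
  by (simp add: gram_weight_def gram_A_def gram_C_def algebra_simps add_divide_distrib)

text \<open>Both sides carry the binomial \<open>Suc (2 * n) choose n\<close>; what is left is the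
  ratio of consecutive series coefficients.\<close>

lemma gram_B_eq: "2 * gram_B n = gram_weight n * (gram_factor n + 1)"
proof -
  have "2 * gram_B n = 2 * ser_coeff n * (ser_coeff n * ((real n + 5 / 2) / (real n + 1))) / (sqrt 6 * 6 ^ n) *
      real (Suc (2 * n) choose n)"
    by (simp only: gram_B_def ser_coeff_Suc power_Suc sqrt6_power)
  also have "\<dots> = gram_weight n * (gram_factor n + 1)"
    unfolding gram_weight_def gram_factor_def by (simp add: power2_eq_square divide_simps)
  finally show ?thesis .
qed

section \<open>Convergence of the Gram series and the key inequality\<close>

lemma summable_gram_A: "summable gram_A"
proof (subst summable_Suc_iff[symmetric], rule summable_comparison_test')
  show "summable (\<lambda>n. gram_weight (Suc n))"
    using summable_gram_weight by (simp add: summable_Suc_iff)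
  show "norm (gram_A (Suc n)) \<le> gram_weight (Suc n)" for n
    using gram_nonneg by (simp add: gram_weight_Suc_eq)
qed

lemma summable_gram_C: "summable gram_C"
proof (rule summable_comparison_test')
  show "summable (\<lambda>n. gram_weight (Suc n))"
    using summable_gram_weight by (simp add: summable_Suc_iff)
  show "norm (gram_C n) \<le> gram_weight (Suc n)" for n
    using gram_nonneg by (simp add: gram_weight_Suc_eq)
qed

lemma summable_gram_B: "summable gram_B"
proof (rule summable_comparison_test')
  show "summable (\<lambda>n. 5 * gram_weight n)"
    by (intro summable_mult summable_gram_weight)
  fix n
  \<comment> \<open>Here \<open>2 / sqrt 6 < 1\<close>, and the fraction is largest at
    \<open>n = 0\<close>. The constant 5 in the comparison is generous.\<close>
  have "2 / sqrt 6 * ((real n + 5 / 2) / (real n + 1)) \<le> 1 * (5 / 2)"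
    using sqrt6_gt_2 by (intro mult_mono) (auto simp: field_simps)
  then have "gram_weight n * (gram_factor n + 1) \<le> gram_weight n * (5 / 2)"
    by (intro mult_left_mono gram_weight_nonneg) (simp add: gram_factor_def)
  with gram_B_eq[of n] gram_weight_nonneg[of n] gram_nonneg(2)[of n] show "norm (gram_B n) \<le> 5 * gram_weight n"
    by simp
qed

text \<open>Degree 0 occurs in \<open>gram_A\<close> but has no partner in \<open>gram_C\<close>, so
  it is split off before the sums are merged into the weights. The difference of the two sides is
  then the series already shown positive.\<close>

lemma gram_inequality: "suminf gram_A + suminf gram_C < 2 * suminf gram_B"
proof -
  have "suminf gram_weight = gram_A 0 + (\<Sum>n. gram_A (Suc n) + gram_C n)"
    using suminf_split_head[OF summable_gram_weight] by (simp add: gram_weight_0_eq gram_weight_Suc_eq)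
  also have "\<dots> = suminf gram_A + suminf gram_C"
    using suminf_add[of "\<lambda>n. gram_A (Suc n)" gram_C] suminf_split_head[OF summable_gram_A]
      summable_gram_A summable_gram_C
    by (simp add: summable_Suc_iff)
  finally have AC: "suminf gram_weight = suminf gram_A + suminf gram_C" .
  have wt: "gram_weight n * gram_factor n = 2 * gram_B n - gram_weight n" for n
    using gram_B_eq[of n] by (simp add: algebra_simps)
  have "(\<lambda>n. gram_weight n * gram_factor n) sums (2 * suminf gram_B - suminf gram_weight)"
    unfolding wt by (intro sums_diff sums_mult summable_sums summable_gram_B summable_gram_weight)
  with suminf_weight_factor_pos have "2 * suminf gram_B - suminf gram_weight > 0"
    by (simp add: sums_iff)
  with AC show ?thesis by simp
qed

section \<open>The zero on the diagonal of the bidisc\<close>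

theorem mainTheorem1:
  fixes f :: "complex \<times> complex \<Rightarrow> complex"
  assumes "f = (\<lambda>(z1, z2). (1 - (z1 + z2) / complex_of_real (sqrt 6)) powr (- (5 / 2)))"
  shows "(\<exists>!p. is_opa1 f p) \<and> (\<forall>p. is_opa1 f p \<longrightarrow> (\<exists>z\<in>bidisc. p z = 0))"
proof -
  define A B C where ABC: "A = suminf gram_A" "B = suminf gram_B" "C = suminf gram_C"
  have XX: "((\<lambda>x. coeff_f x * coeff_f x) has_sum A) UNIV"
    unfolding ABC by (rule has_sum_diagonal_nonneg) (simp_all add: gram_A_diagonal summable_gram_A)
  have B: "((\<lambda>(k, l). coeff_f (k, l) * coeff_f (Suc k, l)) has_sum B) UNIV"
    unfolding ABC
    by (rule has_sum_diagonal_nonneg)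
       (auto simp: gram_B_diagonal summable_gram_B coeff_f_nonneg)
  have XY: "((\<lambda>x. coeff_f x * shift1 coeff_f x) has_sum B) UNIV"
    by (subst has_sum_Suc_fst) (use B in \<open>simp_all add: shift1_def mult.commute\<close>)
  \<comment> \<open>Swapping the two indices and the symmetry of \<open>coeff_f\<close> reduce this
    to the sum for \<open>B\<close>.\<close>
  have XZ: "((\<lambda>x. coeff_f x * shift2 coeff_f x) has_sum B) UNIV"
    by (subst has_sum_Suc_snd, simp add: shift2_def, subst has_sum_prod_swap)
       (use B in \<open>simp add: shift2_def mult.commute coeff_f_swap[of "Suc _"] coeff_f_swap\<close>)
  have "((\<lambda>(k, l). coeff_f (k, Suc l) * coeff_f (Suc k, l)) has_sum C) UNIV"
    unfolding ABC
    by (rule has_sum_diagonal_nonneg)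
       (auto simp: gram_C_diagonal summable_gram_C coeff_f_nonneg)
  then have YZ: "((\<lambda>x. shift1 coeff_f x * shift2 coeff_f x) has_sum C) UNIV"
    by (subst has_sum_Suc_fst, simp add: shift1_def, subst has_sum_Suc_snd)
       (simp_all add: shift1_def shift2_def)
  have hardy: "f \<in> hardy2"
  proof -
    have "(\<lambda>x. (cmod (of_real (coeff_f x)))\<^sup>2) summable_on UNIV"
      using XX by (auto simp: summable_on_def power2_eq_square)
    then show ?thesis
      using holomorphic_f expands_coeff_f unfolding hardy2_def assms by blast
  qed
  have nonneg: "A \<ge> 0" "B \<ge> 0" "C \<ge> 0"
    unfolding ABC by (intro suminf_nonneg summable_gram_A summable_gram_B summable_gram_C gram_nonneg)+
  have less: "A + C < 2 * B"
    using gram_inequality by (simp add: ABC)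
  have "coeff_f (0, 0) = 1"
    by (simp add: coeff_f_def)
  then obtain \<alpha> where iff: "\<And>p. is_opa1 f p \<longleftrightarrow>
    p = (\<lambda>(z1, z2). of_real \<alpha> + of_real (- \<alpha> * B / (A + C)) * z1 + of_real (- \<alpha> * B / (A + C)) * z2)"
    using is_opa1_iff_normal_equations[OF hardy expands_coeff_f[folded assms] _ XX XY XZ YZ nonneg(3)]
    by blast
  have "A \<ge> 1"
    using finite_sum_le_has_sum[OF XX, of "{(0, 0)}"] \<open>coeff_f (0, 0) = 1\<close> by simp
  with nonneg have AC: "A + C > 0" by simp
  \<comment> \<open>The solution of \<open>1 - 2 * x * B / (A + C) = 0\<close>, that is, the zero on
    \<open>z1 = z2\<close>; the inequality \<open>less\<close> puts it inside the disc.\<close>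
  define x where "x = (A + C) / (2 * B)"
  have x: "\<bar>x\<bar> < 1"
    using less AC by (simp add: x_def)
  have "\<alpha> + - \<alpha> * B / (A + C) * x + - \<alpha> * B / (A + C) * x = 0"
    using AC less by (simp add: x_def)
  then have "complex_of_real (\<alpha> + - \<alpha> * B / (A + C) * x + - \<alpha> * B / (A + C) * x) = 0"
    by simp
  then have "is_opa1 f p \<Longrightarrow> p (of_real x, of_real x) = 0" for p
    by (simp add: iff)
  moreover have "(complex_of_real x, complex_of_real x) \<in> bidisc"
    using x by simp
  ultimately show ?thesis
    unfolding iff by blast
qed

end
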